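(* Let $\mathsf{A}=\{A_i\colon i\in\mathcal{I}\}\subset M_d(\mathbb{R})$ be a compact and nonempty set such that $\varrho(\mathsf{A})=1$. Suppose that there exist an integer $k$ in the range $1\leq k<d$, an invertible matrix $X\in M_d(\mathbb{R})$ and sets of matrices $\mathsf{B}=\{B_i\colon i\in\mathcal{I}\}\subseteq M_k(\mathbb{R})$, $\mathsf{C}=\{C_i\colon i\in\mathcal{I}\}\subset M_{d-k}(\mathbb{R})$ and $\mathsf{D}=\{D_i\colon i\in\mathcal{I}\}\subset M_{k\times(d-k)}(\mathbb{R})$ such that \[A_i=X^{-1}\begin{pmatrix}B_i&D_i\\0&C_i\end{pmatrix}X\] for every $i\in\mathcal{I}$. Suppose that both $\mathsf{B}$ and $\mathsf{C}$ are product bounded, and let $(a_n)$ denote the marginal instability rate sequence of $\mathsf{A}$ (with respect to any norm on $M_d(\mathbb{R})$). Then there exists a positive subadditive sequence $(\alpha_n)_{n=1}^\infty$ (that is, $\alpha_n>0$ and $\alpha_{n+m}\leq\alpha_n+\alpha_m$ for all $n,m\geq 1$) such that $a_n\simeq 1+\alpha_n$. In particular $(a_n)$ is weakly upper regularly varying, and the sequence $(a_n/n)$ either converges to zero or is bounded away from zero and infinity.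
   Context: $M_d(\mathbb{R})$ is the set of $d\times d$ real matrices, $M_{d_1\times d_2}(\mathbb{R})$ the set of real $d_1\times d_2$ matrices, and $\|\cdot\|$ is the Euclidean operator norm. For $\mathsf{A}\subset M_d(\mathbb{R})$ and $n\geq 1$, $\mathsf{A}_n:=\{A_1\cdots A_n\colon A_i\in\mathsf{A}\}$ (products of $n$ elements of $\mathsf{A}$). The joint spectral radius of a bounded nonempty set $\mathsf{A}$ is $\varrho(\mathsf{A})=\lim_{n\to\infty}\sup_{A\in\mathsf{A}_n}\|A\|^{1/n}$. If $\varrho(\mathsf{A})=1$, the marginal instability rate sequence of $\mathsf{A}$ with respect to a norm $|||\cdot|||$ on $M_d(\mathbb{R})$ is $(a_n)_{n=1}^\infty$ with $a_n=\max_{A\in\mathsf{A}_n}|||A|||$. A set $\mathsf{A}$ is product bounded if $\sup_{n\geq 1}\sup_{A\in\mathsf{A}_n}\|A\|<\infty$. For sequences of positive reals, $a_n\simeq b_n$ means there is $C>0$ with $C^{-1}b_n\leq a_n\leq Cb_n$ for all $n\geq 1$. A sequence $(a_n)$ of positive reals is weakly upper regularly varying if for every $m\geq 1$ there exists $C_m>0$ such that $a_{nm}\leq C_ma_n$ for all $n\geq 1$. *)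

theory Defs
  imports "HOL-Analysis.Analysis"
begin

text \<open>The Euclidean operator norm. (The instance \<open>norm\<close> on \<open>real^'n^'m\<close> is the Frobenius norm.)\<close>

definition opnorm :: "real^'n^'m \<Rightarrow> real" where
  "opnorm M = onorm (\<lambda>v. M *v v)"

definition matrix_products :: "(real^'n^'n) set \<Rightarrow> nat \<Rightarrow> (real^'n^'n) set" where
  "matrix_products S n = {foldr (**) Ms (mat 1) | Ms. length Ms = n \<and> set Ms \<subseteq> S}"

text \<open>Meaningful for bounded nonempty \<open>S\<close>; for these the limit exists.\<close>

definition joint_spectral_radius :: "(real^'n^'n) set \<Rightarrow> real" where
  "joint_spectral_radius S = lim (\<lambda>n. SUP M\<in>matrix_products S n. root n (opnorm M))"

definition product_bounded :: "(real^'n^'n) set \<Rightarrow> bool" where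
  "product_bounded S \<longleftrightarrow> bdd_above (\<Union>n\<in>{1..}. opnorm ` matrix_products S n)"

definition is_norm :: "('a::real_vector \<Rightarrow> real) \<Rightarrow> bool" where
  "is_norm N \<longleftrightarrow>
     (\<forall>x. 0 \<le> N x) \<and> (\<forall>x. N x = 0 \<longleftrightarrow> x = 0) \<and>
     (\<forall>c x. N (c *\<^sub>R x) = \<bar>c\<bar> * N x) \<and> (\<forall>x y. N (x + y) \<le> N x + N y)"

text \<open>The maximum is attained when \<open>S\<close> is compact and nonempty and \<open>N\<close> is a norm.\<close>

definition marginal_instability_rate ::
    "(real^'n^'n \<Rightarrow> real) \<Rightarrow> (real^'n^'n) set \<Rightarrow> nat \<Rightarrow> real" where
  "marginal_instability_rate N S n = (GREATEST x. x \<in> N ` matrix_products S n)"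

text \<open>The block matrix with rows \<open>(P Q)\<close> and \<open>(R S)\<close>: the index type \<open>'k + 'l\<close>
  lists the first \<open>CARD('k)\<close> coordinates as \<open>Inl\<close> and the remaining \<open>CARD('l)\<close> as \<open>Inr\<close>.\<close>

definition block_matrix ::
    "real^'k^'k \<Rightarrow> real^'l^'k \<Rightarrow> real^'k^'l \<Rightarrow> real^'l^'l \<Rightarrow> real^('k + 'l)^('k + 'l)" where
  "block_matrix P Q R S =
     (\<chi> i j. case i of
        Inl r \<Rightarrow> (case j of Inl c \<Rightarrow> P $ r $ c | Inr c \<Rightarrow> Q $ r $ c)
      | Inr r \<Rightarrow> (case j of Inl c \<Rightarrow> R $ r $ c | Inr c \<Rightarrow> S $ r $ c))"

text \<open>Sequences are indexed from 1; their value at 0 is irrelevant throughout.\<close>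

definition seq_comparable :: "(nat \<Rightarrow> real) \<Rightarrow> (nat \<Rightarrow> real) \<Rightarrow> bool" where
  "seq_comparable a b \<longleftrightarrow>
     (\<forall>n\<ge>1. 0 < a n \<and> 0 < b n) \<and>
     (\<exists>C>0. \<forall>n\<ge>1. inverse C * b n \<le> a n \<and> a n \<le> C * b n)"

definition weakly_upper_regularly_varying :: "(nat \<Rightarrow> real) \<Rightarrow> bool" where
  "weakly_upper_regularly_varying a \<longleftrightarrow>
     (\<forall>n\<ge>1. 0 < a n) \<and>
     (\<forall>m\<ge>1. \<exists>C>0. \<forall>n\<ge>1. a (n * m) \<le> C * a n)"

end

theory Submission
  imports Defs
begin

text \<open>
  For words \<open>v\<close>, \<open>w\<close> the off-diagonal blocks satisfy \<open>D\<^bsub>vw\<^esub> = B\<^sub>v D\<^sub>w + D\<^sub>v C\<^sub>w\<close>. Hence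
  \<open>\<alpha>\<^sub>n = 1 + sup \<parallel>B\<^sub>u D\<^sub>w C\<^sub>v\<parallel>\<close>, over words \<open>w\<close> of length \<open>n\<close> and arbitrary words \<open>u\<close>, \<open>v\<close>,
  is subadditive, because \<open>B\<^sub>u B\<^sub>p\<close> and \<open>C\<^sub>q C\<^sub>v\<close> are again products along words. Product
  boundedness of the diagonal blocks makes this supremum comparable to \<open>sup \<parallel>D\<^sub>w\<parallel>\<close>. Finally
  \<open>a\<^sub>n\<close> is bounded below by a positive constant, because by Fekete's lemma a product length
  at which all norms are less than 1 would force the joint spectral radius below 1.
\<close>

section \<open>Submultiplicative and subadditive sequences\<close>

text \<open>The upper half of Fekete's lemma. After division by \<open>x ^ n\<close> the term at
  \<open>m\<close> is some \<open>r < 1\<close>. Splitting n into blocks of length \<open>m\<close>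
  and a remainder, each block costs a factor \<open>r\<close> and the remainder at most
  \<open>K\<close>, so the quotient is at most \<open>K * r ^ (n div m)\<close>, which tends to 0.
  Powers instead of roots let \<open>s\<close> vanish and avoid logarithms.\<close>

lemma submultiplicative_eventually_less_power:
  fixes s :: "nat \<Rightarrow> real"
  assumes nonneg: "\<And>n. 0 \<le> s n"
    and submult: "\<And>n m. s (n + m) \<le> s n * s m"
    and m: "m \<ge> 1" and x: "x > 0" and less: "s m < x ^ m"
  shows "\<forall>\<^sub>F n in sequentially. s n < x ^ n"
proof -
  define u where "u n = s n / x ^ n" for n
  have u0: "0 \<le> u n" for n using nonneg x by (simp add: u_def)
  have umult: "u (n + l) \<le> u n * u l" for n l
    using submult[of n l] x by (simp add: u_def power_add divide_right_mono)
  define r where "r = u m"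
  have r: "0 \<le> r" "r < 1" using u0 less x by (auto simp: r_def u_def)
  define K where "K = (\<Sum>i<m. u i)"
  have K: "u i \<le> K" if "i < m" for i
    unfolding K_def using that u0 by (intro member_le_sum) auto
  have upow: "u (q * m + i) \<le> r ^ q * u i" for q i
  proof (induction q)
    case (Suc q)
    have "u (Suc q * m + i) \<le> r * u (q * m + i)"
      using umult[of m "q * m + i"] by (simp add: r_def add.assoc)
    also have "\<dots> \<le> r * (r ^ q * u i)" using Suc r by (intro mult_left_mono) auto
    finally show ?case by simp
  qed simp
  have bound: "u n \<le> K * r ^ (n div m)" for n
  proof -
    have "u n \<le> r ^ (n div m) * u (n mod m)" using upow[of "n div m" "n mod m"] by simp
    also have "\<dots> \<le> r ^ (n div m) * K" using K[of "n mod m"] m r by (intro mult_left_mono) auto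
    finally show ?thesis by (simp add: mult.commute)
  qed
  have "filterlim (\<lambda>n. n div m) sequentially sequentially"
    using m by (intro filterlim_at_top_div_const_nat) auto
  then have "(\<lambda>n. K * r ^ (n div m)) \<longlonglongrightarrow> K * 0"
    by (intro tendsto_mult tendsto_const filterlim_compose[OF LIMSEQ_power_zero]) (use r in auto)
  then have "\<forall>\<^sub>F n in sequentially. K * r ^ (n div m) < 1"
    by (rule order_tendstoD(2)) simp
  then show ?thesis
  proof eventually_elim
    case (elim n)
    then have "u n < 1" using bound[of n] by simp
    then show ?case using x by (simp add: u_def)
  qed
qed

text \<open>Exponentiation turns subadditivity into submultiplicativity, with \<open>exp y\<close>
  as the threshold \<open>x\<close>.\<close>

lemma subadditive_eventually_less:
  fixes \<alpha> :: "nat \<Rightarrow> real"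
  assumes subadd: "\<And>n m. \<alpha> (n + m) \<le> \<alpha> n + \<alpha> m"
    and m: "m \<ge> 1" and less: "\<alpha> m / m < y"
  shows "\<forall>\<^sub>F n in sequentially. \<alpha> n / n < y"
proof -
  have "\<forall>\<^sub>F n in sequentially. exp (\<alpha> n) < exp y ^ n"
  proof (rule submultiplicative_eventually_less_power[where s = "\<lambda>n. exp (\<alpha> n)" and m = m])
    show "exp (\<alpha> m) < exp y ^ m"
      using less m by (simp add: exp_of_nat_mult[symmetric] field_simps)
  qed (use subadd m in \<open>auto simp: exp_add[symmetric]\<close>)
  then show ?thesis using eventually_gt_at_top[of 0]
    by eventually_elim (simp add: exp_of_nat_mult[symmetric] field_simps)
qed

lemma subadditive_mult_le:
  fixes \<alpha> :: "nat \<Rightarrow> real"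
  assumes subadd: "\<And>n m. \<alpha> (n + m) \<le> \<alpha> n + \<alpha> m" and "m \<ge> 1"
  shows "\<alpha> (n * m) \<le> real m * \<alpha> n"
  using \<open>m \<ge> 1\<close>
proof (induction m rule: dec_induct)
  case (step m)
  then show ?case using subadd[of n "n * m"] by (simp add: algebra_simps)
qed simp

text \<open>Without a positive lower bound, the mean drops below any given \<open>y > 0\<close> at
  some index, and then, by Fekete, at all large indices. Positivity handles the lower side of the
  limit.\<close>

lemma subadditive_mean_dichotomy:
  fixes \<alpha> :: "nat \<Rightarrow> real"
  assumes subadd: "\<And>n m. \<alpha> (n + m) \<le> \<alpha> n + \<alpha> m"
    and pos: "\<And>n. 0 < \<alpha> n"
  obtains "(\<lambda>n. \<alpha> n / n) \<longlonglongrightarrow> 0"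
    | c where "0 < c" "\<And>n. n \<ge> 1 \<Longrightarrow> c \<le> \<alpha> n / n"
proof (cases "\<exists>c>0. \<forall>n\<ge>1. c \<le> \<alpha> n / n")
  case False
  have "(\<lambda>n. \<alpha> n / n) \<longlonglongrightarrow> 0"
  proof (rule order_tendstoI)
    fix y :: real assume "y > 0"
    with False obtain m where "m \<ge> 1" "\<alpha> m / m < y" by (meson not_le)
    then show "\<forall>\<^sub>F n in sequentially. \<alpha> n / n < y"
      using subadditive_eventually_less[of \<alpha> m y] subadd by blast
  next
    fix y :: real assume "y < 0"
    then show "\<forall>\<^sub>F n in sequentially. y < \<alpha> n / n"
      by (intro always_eventually allI) (rule less_le_trans[OF \<open>y < 0\<close>], simp add: pos less_imp_le)
  qed
  then show ?thesis by (rule that(1))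
qed (use that(2) in blast)

section \<open>Norms on finite-dimensional spaces\<close>

text \<open>One half of the equivalence of norms: expand \<open>x\<close> in the standard basis and
  bound each coordinate by \<open>norm x\<close>. The summand 1 in the constant makes it visibly
  positive.\<close>

lemma is_norm_bounded_by_norm:
  fixes N :: "'a::euclidean_space \<Rightarrow> real"
  assumes "is_norm N"
  obtains K where "K > 0" "\<And>x. N x \<le> K * norm x"
proof -
  have N: "0 \<le> N x" "N (c *\<^sub>R x) = \<bar>c\<bar> * N x" "N (x + y) \<le> N x + N y" "N 0 = 0" for x y c
    using assms by (auto simp: is_norm_def)
  have sum: "N (sum f S) \<le> (\<Sum>b\<in>S. N (f b))" if "finite S" for S and f :: "'a \<Rightarrow> 'a"
    using that
  proof (induction S rule: finite_induct)
    case (insert b S)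
    then show ?case using N(3)[of "f b" "sum f S"] by simp
  qed (simp add: N)
  have "N x \<le> (1 + (\<Sum>b\<in>Basis. N b)) * norm x" for x
  proof -
    have "N x = N (\<Sum>b\<in>Basis. (x \<bullet> b) *\<^sub>R b)" by (simp add: euclidean_representation)
    also have "\<dots> \<le> (\<Sum>b\<in>Basis. \<bar>x \<bullet> b\<bar> * N b)" using sum[OF finite_Basis, of "\<lambda>b. (x \<bullet> b) *\<^sub>R b"] by (simp add: N)
    also have "\<dots> \<le> (\<Sum>b\<in>Basis. norm x * N b)"
      by (intro sum_mono mult_right_mono) (auto simp: N Basis_le_norm)
    also have "\<dots> \<le> (1 + (\<Sum>b\<in>Basis. N b)) * norm x"
      unfolding sum_distrib_left[symmetric] by (simp add: algebra_simps)
    finally show ?thesis .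
  qed
  moreover have "0 < 1 + (\<Sum>b\<in>Basis. N b)" using N by (simp add: add_pos_nonneg sum_nonneg)
  ultimately show ?thesis using that by blast
qed

lemma is_norm_continuous_on:
  fixes N :: "'a::euclidean_space \<Rightarrow> real"
  assumes "is_norm N"
  shows "continuous_on S N"
proof -
  have scale: "N (c *\<^sub>R x) = \<bar>c\<bar> * N x" and N: "N (x + y) \<le> N x + N y" for c x y
    using assms by (auto simp: is_norm_def)
  have minus: "N (x - y) = N (y - x)" for x y using scale[of "- 1" "y - x"] by simp
  obtain K where K: "K > 0" "\<And>x. N x \<le> K * norm x" using is_norm_bounded_by_norm[OF assms] by blast
  have "\<bar>N x - N y\<bar> \<le> K * norm (x - y)" for x y
    using N[of "x - y" y] N[of "y - x" x] minus[of x y] K(2)[of "x - y"] by simp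
  then have "K-lipschitz_on S N"
    using K(1) by (intro lipschitz_onI) (auto simp: dist_norm)
  then show ?thesis by (rule lipschitz_on_continuous_on)
qed

text \<open>The other half: by continuity \<open>N\<close> attains a minimum on the compact unit
  sphere, positive by definiteness, and homogeneity extends the bound to all vectors.\<close>

lemma is_norm_bounds_norm:
  fixes N :: "'a::euclidean_space \<Rightarrow> real"
  assumes "is_norm N"
  obtains K where "K > 0" "\<And>x. norm x \<le> K * N x"
proof -
  have N: "0 \<le> N x" "N (c *\<^sub>R x) = \<bar>c\<bar> * N x" "N x = 0 \<longleftrightarrow> x = 0" for x c
    using assms by (auto simp: is_norm_def)
  obtain z where z: "z \<in> sphere 0 1" "\<And>x. x \<in> sphere 0 1 \<Longrightarrow> N z \<le> N x"
    using continuous_attains_inf[OF compact_sphere _ is_norm_continuous_on[OF assms], of 0 1] by auto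
  have "N z > 0" using N(1)[of z] N(3)[of z] z(1) by (auto simp: less_le)
  moreover have "norm x \<le> inverse (N z) * N x" for x
  proof (cases "x = 0")
    case False
    have "N z \<le> N (inverse (norm x) *\<^sub>R x)" using False by (intro z) auto
    then show ?thesis using False \<open>N z > 0\<close> by (simp add: N field_simps)
  qed (use N in auto)
  ultimately show ?thesis using that[of "inverse (N z)"] by simp
qed

lemma opnorm_nonneg: "0 \<le> opnorm M"
  unfolding opnorm_def by (intro onorm_pos_le matrix_vector_mul_bounded_linear)

lemma opnorm_add: "opnorm (P + Q) \<le> opnorm P + opnorm Q"
  unfolding opnorm_def matrix_vector_mult_add_rdistrib
  by (intro onorm_triangle matrix_vector_mul_bounded_linear)

lemma opnorm_mult: "opnorm (P ** Q) \<le> opnorm P * opnorm Q"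
proof -
  have "opnorm (P ** Q) = onorm ((*v) P \<circ> (*v) Q)"
    by (simp add: opnorm_def o_def matrix_vector_mul_assoc)
  then show ?thesis
    unfolding opnorm_def by (simp add: onorm_compose matrix_vector_mul_bounded_linear)
qed

lemma opnorm_mat_1: "opnorm (mat 1 :: real^'n^'n) \<le> 1"
  using onorm_id_le by (simp add: opnorm_def matrix_vector_mul_lid)

text \<open>Through this fact the norm equivalence above links \<open>opnorm\<close>, the Frobenius
  norm and an arbitrary \<open>N\<close>.\<close>

lemma is_norm_opnorm: "is_norm (opnorm :: real^'n^'m \<Rightarrow> real)"
proof -
  have "opnorm (c *\<^sub>R M) = \<bar>c\<bar> * opnorm M" for c and M :: "real^'n^'m"
    unfolding opnorm_def scaleR_matrix_vector_assoc[symmetric]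
    by (intro onorm_scaleR matrix_vector_mul_bounded_linear)
  moreover have "opnorm M = 0 \<longleftrightarrow> M = 0" for M :: "real^'n^'m"
    unfolding opnorm_def onorm_eq_0[OF matrix_vector_mul_bounded_linear]
    by (simp add: matrix_eq)
  ultimately show ?thesis by (auto simp: is_norm_def opnorm_nonneg opnorm_add)
qed

section \<open>Matrix products along words\<close>

text \<open>Products are indexed by words over the index set, not by matrices: one word picks
  matching factors from \<open>A\<close>, \<open>B\<close>, \<open>C\<close> and \<open>D\<close> at
  once, whereas an element of the set of the \<open>A i\<close> need not determine its
  index.\<close>

definition words :: "'i set \<Rightarrow> nat \<Rightarrow> 'i list set" where
  "words I n = {w. length w = n \<and> set w \<subseteq> I}"

definition word_product :: "('i \<Rightarrow> real^'n^'n) \<Rightarrow> 'i list \<Rightarrow> real^'n^'n" where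
  "word_product A w = foldr (**) (map A w) (mat 1)"

lemma word_product_simps [simp]:
  "word_product A [] = mat 1" "word_product A (i # w) = A i ** word_product A w"
  by (simp_all add: word_product_def)

lemma word_product_append: "word_product A (v @ w) = word_product A v ** word_product A w"
  by (induction v) (simp_all add: matrix_mul_assoc)

lemma words_conv_lists: "words I n = lists I \<inter> {w. length w = n}"
  by (auto simp: words_def in_lists_conv_set)

lemma words_image: "words (f ` I) n = map f ` words I n"
  unfolding words_conv_lists lists_image by auto

lemma matrix_products_image: "matrix_products (A ` I) n = word_product A ` words I n"
proof -
  have "matrix_products (A ` I) n = (\<lambda>Ms. foldr (**) Ms (mat 1)) ` words (A ` I) n"
    unfolding matrix_products_def words_def by (rule setcompr_eq_image)
  then show ?thesis by (simp add: words_image image_image word_product_def)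
qed

lemma words_nonempty: "I \<noteq> {} \<Longrightarrow> words I n \<noteq> {}"
proof -
  assume "I \<noteq> {}"
  then obtain i where "i \<in> I" by blast
  then have "replicate n i \<in> words I n" by (auto simp: words_def)
  then show ?thesis by blast
qed

lemma words_addE:
  assumes "w \<in> words I (n + m)"
  obtains u v where "w = u @ v" "u \<in> words I n" "v \<in> words I m"
  using assms that[of "take n w" "drop n w"] set_take_subset[of n w] set_drop_subset[of n w]
  by (auto simp: words_def)

text \<open>Product boundedness speaks of lengths at least 1 only. The maximum with 1 also covers
  the empty word, which occurs later as an outer factor.\<close>

lemma product_bounded_word_product:
  fixes B :: "'i \<Rightarrow> real^'n^'n"
  assumes "product_bounded (B ` I)"
  obtains K where "K \<ge> 1" "\<And>w. set w \<subseteq> I \<Longrightarrow> opnorm (word_product B w) \<le> K"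
proof -
  obtain K where K: "\<And>n M. n \<ge> 1 \<Longrightarrow> M \<in> matrix_products (B ` I) n \<Longrightarrow> opnorm M \<le> K"
    using assms by (fastforce simp: product_bounded_def bdd_above_def)
  have "opnorm (word_product B w) \<le> max 1 K" if "set w \<subseteq> I" for w
  proof (cases "w = []")
    case False
    then show ?thesis using K[of "length w" "word_product B w"] that
      by (auto simp: matrix_products_image words_def Suc_le_eq le_max_iff_disj)
  qed (use opnorm_mat_1[where 'n='n] in \<open>simp add: le_max_iff_disj\<close>)
  then show ?thesis using that[of "max 1 K"] by simp
qed

lemma matrix_add_rdistrib:
  fixes P Q :: "'a::semiring_1^'n^'m"
  shows "(P + Q) ** R = P ** R + Q ** R"
  by (simp add: matrix_matrix_mult_def vec_eq_iff distrib_right sum.distrib)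

lemma bounded_bilinear_matrix_mult:
  "bounded_bilinear ((**) :: real^'n^'m \<Rightarrow> real^'p^'n \<Rightarrow> real^'p^'m)"
proof -
  have "(c *\<^sub>R P) ** Q = c *\<^sub>R (P ** Q)" "P ** (c *\<^sub>R Q) = c *\<^sub>R (P ** Q)"
    for c and P :: "real^'n^'m" and Q :: "real^'p^'n"
    by (simp_all add: matrix_matrix_mult_def vec_eq_iff sum_distrib_left mult_ac)
  then show ?thesis
    unfolding bilinear_conv_bounded_bilinear[symmetric]
    by (simp add: bilinear_def linear_iff matrix_add_ldistrib matrix_add_rdistrib)
qed

text \<open>Multiplication is continuous, so each further factor gives a continuous image of a
  product of two compact sets.\<close>

lemma compact_matrix_products:
  assumes "compact S"
  shows "compact (matrix_products S n)"
proof (induction n)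
  case 0
  have "matrix_products S 0 = {mat 1}" by (auto simp: matrix_products_def)
  then show ?case by simp
next
  case (Suc n)
  have "matrix_products S (Suc n) = (\<lambda>(P, Q). P ** Q) ` (S \<times> matrix_products S n)"
  proof (intro set_eqI iffI)
    fix M assume "M \<in> (\<lambda>(P, Q). P ** Q) ` (S \<times> matrix_products S n)"
    then obtain P Ms where "M = P ** foldr (**) Ms (mat 1)" "P \<in> S" "length Ms = n" "set Ms \<subseteq> S"
      by (auto simp: matrix_products_def)
    then show "M \<in> matrix_products S (Suc n)"
      by (auto simp: matrix_products_def intro!: exI[of _ "P # Ms"])
  qed (fastforce simp: matrix_products_def length_Suc_conv)
  moreover have "continuous_on (S \<times> matrix_products S n) (\<lambda>(P, Q). P ** Q)"
    unfolding case_prod_unfold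
    by (intro bounded_bilinear.continuous_on[OF bounded_bilinear_matrix_mult] continuous_intros)
  ultimately show ?case
    using compact_continuous_image[OF _ compact_Times[OF assms Suc]] by metis
qed

text \<open>Compactness supplies a maximum, and only then does \<open>GREATEST\<close> denote what
  it should.\<close>

lemma marginal_instability_rate_max:
  assumes "compact S" "matrix_products S n \<noteq> {}" "is_norm N"
  shows "marginal_instability_rate N S n \<in> N ` matrix_products S n"
    and "\<And>M. M \<in> matrix_products S n \<Longrightarrow> N M \<le> marginal_instability_rate N S n"
proof -
  obtain M where M: "M \<in> matrix_products S n" "\<forall>P\<in>matrix_products S n. N P \<le> N M"
    using continuous_attains_sup[OF compact_matrix_products[OF assms(1)] assms(2)
        is_norm_continuous_on[OF assms(3)]] by blast
  have "marginal_instability_rate N S n = N M"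
    unfolding marginal_instability_rate_def by (rule Greatest_equality) (use M in auto)
  then show "marginal_instability_rate N S n \<in> N ` matrix_products S n"
    "\<And>M. M \<in> matrix_products S n \<Longrightarrow> N M \<le> marginal_instability_rate N S n"
    using M by auto
qed

text \<open>By Fekete's lemma the limit defining the joint spectral radius is also the infimum of
  its terms over lengths at least 1. A bound below 1 at one length \<open>m\<close> would therefore
  push the radius below 1.\<close>

lemma joint_spectral_radius_one_imp:
  fixes S :: "(real^'n^'n) set"
  assumes S: "bounded S" "S \<noteq> {}" and jsr: "joint_spectral_radius S = 1"
    and m: "m \<ge> 1" and y: "\<And>M. M \<in> matrix_products S m \<Longrightarrow> opnorm M \<le> y"
  shows "1 \<le> y"
proof (rule ccontr)
  assume "\<not> 1 \<le> y"
  define s where "s n = (SUP M\<in>matrix_products S n. opnorm M)" for n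
  define t where "t n = (SUP M\<in>matrix_products S n. root n (opnorm M))" for n
  \<comment> \<open>The set \<open>S\<close> serves as its own index set, so that the facts on words
    apply.\<close>
  define W where "W = word_product (\<lambda>M::real^'n^'n. M)"
  have products: "matrix_products S n = W ` words S n" for n
    using matrix_products_image[of "\<lambda>M. M" S n] by (simp add: W_def)
  have ne: "matrix_products S n \<noteq> {}" for n
    using words_nonempty[OF S(2)] by (simp add: products)
  obtain K0 where K0: "\<And>M. M \<in> S \<Longrightarrow> norm M \<le> K0" using S(1) by (auto simp: bounded_iff)
  obtain K1 where K1: "K1 > 0" "\<And>M::real^'n^'n. opnorm M \<le> K1 * norm M"
    using is_norm_bounded_by_norm[OF is_norm_opnorm] by blast
  have K: "opnorm M \<le> K1 * K0" if "M \<in> S" for M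
    using K1(2)[of M] mult_left_mono[OF K0[OF that], of K1] K1(1) by linarith
  have Kw: "opnorm (W w) \<le> (K1 * K0) ^ length w" if "set w \<subseteq> S" for w
    using that
  proof (induction w)
    case (Cons M w)
    have K_nonneg: "0 \<le> K1 * K0" using Cons K[of M] opnorm_nonneg[of M] by simp
    have "opnorm (M ** W w) \<le> opnorm M * opnorm (W w)"
      by (rule opnorm_mult)
    also have "\<dots> \<le> (K1 * K0) * (K1 * K0) ^ length w"
      using Cons K K_nonneg by (intro mult_mono) (auto simp: opnorm_nonneg)
    finally show ?case by (simp add: W_def)
  qed (simp add: W_def opnorm_mat_1)
  have bdd: "bdd_above (opnorm ` matrix_products S n)" for n
    using Kw products
    by (auto simp: words_def intro!: bdd_aboveI[of _ "(K1 * K0) ^ n"])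
  have s_ge: "opnorm M \<le> s n" if "M \<in> matrix_products S n" for M n
    unfolding s_def using that bdd by (rule cSUP_upper)
  have s0: "0 \<le> s n" for n using ne[of n] s_ge opnorm_nonneg by (meson ex_in_conv order_trans)
  have s_submult: "s (n + l) \<le> s n * s l" for n l
  proof -
    have "opnorm M \<le> s n * s l" if M: "M \<in> matrix_products S (n + l)" for M
    proof -
      obtain w where w: "M = W w" "w \<in> words S (n + l)"
        using M by (auto simp: products)
      then obtain u v where "w = u @ v" "u \<in> words S n" "v \<in> words S l" by (blast elim: words_addE)
      then have "opnorm (W u) \<le> s n" "opnorm (W v) \<le> s l"
          "M = W u ** W v"
        using s_ge products w by (auto simp: W_def word_product_append)
      then show ?thesis
        using opnorm_mult[of "W u" "W v"]
          mult_mono[of "opnorm (W u)" "s n" "opnorm (W v)" "s l"] s0 opnorm_nonneg[of "W v"] by simp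
    qed
    then show ?thesis unfolding s_def[of "n + l"] using ne by (intro cSUP_least) auto
  qed
  \<comment> \<open>The definition takes the supremum of roots, Fekete's lemma needs the root of the
    supremum. They agree because \<open>root n\<close> is monotone and continuous.\<close>
  have t_eq: "t n = root n (s n)" if "n \<ge> 1" for n
    unfolding t_def s_def
    using that ne bdd
    by (subst continuous_at_Sup_mono[of "root n"])
      (auto simp: mono_def image_image isCont_real_root intro: continuous_at_imp_continuous_at_within)
  have root_less: "root n (s n) < x \<longleftrightarrow> s n < x ^ n" if "n \<ge> 1" "x > 0" for n x
    using that real_root_less_iff[of n "s n" "x ^ n"] by (simp add: real_root_power_cancel)
  \<comment> \<open>Index 0 must be left out: \<open>root 0\<close> is constantly 0.\<close>
  define L where "L = (INF n\<in>{1..}. t n)"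
  have t0: "0 \<le> t n" if "n \<ge> 1" for n using that s0 by (simp add: t_eq)
  have t_bdd: "bdd_below (t ` {1..})" using t0 by (auto intro!: bdd_belowI[of _ 0])
  have L_le: "L \<le> t n" if "n \<ge> 1" for n
    unfolding L_def using that t_bdd by (intro cINF_lower) auto
  have L0: "0 \<le> L" unfolding L_def using t0 by (intro cINF_greatest) auto
  have "t \<longlonglongrightarrow> L"
  proof (rule order_tendstoI)
    fix x assume x: "x < L"
    show "\<forall>\<^sub>F n in sequentially. x < t n"
      using eventually_ge_at_top[of 1] by eventually_elim (use x L_le in \<open>fastforce intro: less_le_trans\<close>)
  next
    fix x assume x: "L < x"
    then obtain n where n: "n \<ge> 1" "t n < x"
      using cINF_less_iff[OF _ t_bdd, of x] by (auto simp: L_def)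
    have "\<forall>\<^sub>F n in sequentially. s n < x ^ n"
      using n x L0 by (intro submultiplicative_eventually_less_power[where s = s and m = n] s0 s_submult n(1))
        (auto simp: t_eq root_less)
    then show "\<forall>\<^sub>F n in sequentially. t n < x"
      using eventually_ge_at_top[of 1] by eventually_elim (use x L0 in \<open>auto simp: t_eq root_less\<close>)
  qed
  then have "L = lim t" by (simp add: limI)
  then have "L = 1" using jsr by (simp add: joint_spectral_radius_def t_def[abs_def])
  moreover have "s m \<le> y" unfolding s_def using ne y by (intro cSUP_least)
  then have "t m < 1" using m \<open>\<not> 1 \<le> y\<close> s0[of m] by (simp add: t_eq root_less)
  ultimately show False using L_le[OF m] by simp
qed

section \<open>Block matrices\<close>

lemma sum_UNIV_Plus:
  fixes f :: "'k::finite + 'l::finite \<Rightarrow> 'a::comm_monoid_add"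
  shows "(\<Sum>x\<in>UNIV. f x) = (\<Sum>x\<in>UNIV. f (Inl x)) + (\<Sum>x\<in>UNIV. f (Inr x))"
  unfolding UNIV_Plus_UNIV[symmetric] by (simp add: sum.Plus del: UNIV_Plus_UNIV)

lemma block_matrix_nth [simp]:
  "block_matrix P Q R S $ Inl a $ Inl b = P $ a $ b"
  "block_matrix P Q R S $ Inl a $ Inr d = Q $ a $ d"
  "block_matrix P Q R S $ Inr c $ Inl b = R $ c $ b"
  "block_matrix P Q R S $ Inr c $ Inr d = S $ c $ d"
  by (simp_all add: block_matrix_def)

lemma block_matrix_eqI:
  fixes M N :: "'a^('k::finite + 'l::finite)^('k + 'l)"
  assumes "\<And>a b. M $ Inl a $ Inl b = N $ Inl a $ Inl b" "\<And>a d. M $ Inl a $ Inr d = N $ Inl a $ Inr d"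
    "\<And>c b. M $ Inr c $ Inl b = N $ Inr c $ Inl b" "\<And>c d. M $ Inr c $ Inr d = N $ Inr c $ Inr d"
  shows "M = N"
  unfolding vec_eq_iff using assms by (metis sum.exhaust)

lemma block_matrix_mult:
  "block_matrix P Q 0 S ** block_matrix P' Q' 0 S' =
    block_matrix (P ** P') (P ** Q' + Q ** S') 0 (S ** S')"
  by (rule block_matrix_eqI) (simp_all add: matrix_matrix_mult_def sum_UNIV_Plus)

lemma block_matrix_mat_1: "block_matrix (mat 1) 0 0 (mat 1) = mat 1"
  by (rule block_matrix_eqI) (simp_all add: mat_def)

text \<open>Unrolled, this is the sum over the positions in the word of the product with
  \<open>D\<close> at that position, \<open>B\<close> at all earlier ones and \<open>C\<close> at
  all later ones: the upper right block of the triangular product, as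
  \<open>word_product_block\<close> confirms.\<close>

fun word_offdiag ::
    "('i \<Rightarrow> real^'k^'k) \<Rightarrow> ('i \<Rightarrow> real^'l^'k) \<Rightarrow> ('i \<Rightarrow> real^'l^'l) \<Rightarrow> 'i list \<Rightarrow> real^'l^'k" where
  "word_offdiag B D C [] = 0"
| "word_offdiag B D C (i # w) = B i ** word_offdiag B D C w + D i ** word_product C w"

lemma matrix_mult_zero: "M ** 0 = 0" "0 ** M = 0" for M :: "real^'n^'m"
  by (simp_all add: matrix_matrix_mult_def vec_eq_iff)

lemma word_offdiag_append:
  "word_offdiag B D C (v @ w) =
    word_product B v ** word_offdiag B D C w + word_offdiag B D C v ** word_product C w"
  by (induction v)
    (simp_all add: word_product_append matrix_add_ldistrib matrix_add_rdistrib matrix_mul_assoc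
      matrix_mult_zero add.assoc)

lemma word_product_block:
  "word_product (\<lambda>i. block_matrix (B i) (D i) 0 (C i)) w =
    block_matrix (word_product B w) (word_offdiag B D C w) 0 (word_product C w)"
  by (induction w) (simp_all add: block_matrix_mult block_matrix_mat_1)

text \<open>The inner factors \<open>X ** Y\<close> cancel between neighbouring letters.\<close>

lemma word_product_conjugate:
  fixes X :: "real^'n^'n"
  assumes "Y ** X = mat 1" "X ** Y = mat 1" "\<And>i. i \<in> set w \<Longrightarrow> A i = Y ** T i ** X"
  shows "word_product A w = Y ** word_product T w ** X"
  using assms(3)
proof (induction w)
  case (Cons i w)
  have "A i ** word_product A w = Y ** T i ** (X ** Y) ** word_product T w ** X"
    using Cons by (simp add: matrix_mul_assoc)
  then show ?case by (simp add: assms(2) matrix_mul_assoc)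
qed (simp add: assms(1))

text \<open>Assembling the conjugated matrix from its blocks (\<open>f\<close>) and reading off the
  upper right block after undoing the conjugation (\<open>g\<close>) are linear maps in finite
  dimension, hence bounded. Equivalence of norms then passes to \<open>N\<close> and
  \<open>opnorm\<close>.\<close>

lemma block_triangular_norm_bounds:
  fixes N :: "real^('k::finite + 'l::finite)^('k + 'l) \<Rightarrow> real"
  assumes "is_norm N" and XY: "Y ** X = mat 1" "X ** Y = mat 1"
  obtains K where "K > 0"
    "\<And>(P :: real^'k^'k) (Q :: real^'l^'k) S. N (Y ** block_matrix P Q 0 S ** X) \<le> K * (opnorm P + opnorm Q + opnorm S)"
    "\<And>(P :: real^'k^'k) (Q :: real^'l^'k) S. opnorm Q \<le> K * N (Y ** block_matrix P Q 0 S ** X)"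
proof -
  define f :: "(real^'k^'k) \<times> (real^'l^'k) \<times> (real^'l^'l) \<Rightarrow> real^('k + 'l)^('k + 'l)"
    where "f = (\<lambda>(P, Q, S). Y ** block_matrix P Q 0 S ** X)"
  define g :: "real^('k + 'l)^('k + 'l) \<Rightarrow> real^'l^'k"
    where "g M = (\<chi> a d. (X ** M ** Y) $ Inl a $ Inr d)" for M
  interpret mm: bounded_bilinear "(**) :: real^('k + 'l)^('k + 'l) \<Rightarrow> _ \<Rightarrow> real^('k + 'l)^('k + 'l)"
    by (rule bounded_bilinear_matrix_mult)
  have block_add: "block_matrix (P + P') (Q + Q') 0 (S + S') = block_matrix P Q 0 S + block_matrix P' Q' 0 S'"
    for P P' :: "real^'k^'k" and Q Q' :: "real^'l^'k" and S S' by (rule block_matrix_eqI) simp_all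
  have block_scale: "block_matrix (c *\<^sub>R P) (c *\<^sub>R Q) 0 (c *\<^sub>R S) = c *\<^sub>R block_matrix P Q 0 S"
    for P :: "real^'k^'k" and Q :: "real^'l^'k" and S c by (rule block_matrix_eqI) simp_all
  have "linear f"
    by (auto simp: linear_iff f_def block_add block_scale mm.add_left mm.add_right mm.scaleR_left mm.scaleR_right)
  then obtain F where F: "F > 0" "\<And>z. norm (f z) \<le> F * norm z" using linear_bounded_pos by metis
  have "linear g"
    by (auto simp: linear_iff g_def vec_eq_iff mm.add_left mm.add_right mm.scaleR_left mm.scaleR_right)
  then obtain G where G: "G > 0" "\<And>z. norm (g z) \<le> G * norm z" using linear_bounded_pos by metis
  have gf: "g (f (P, Q, S)) = Q" for P Q S
  proof -
    have "X ** (Y ** block_matrix P Q 0 S ** X) ** Y = (X ** Y) ** block_matrix P Q 0 S ** (X ** Y)"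
      by (simp only: matrix_mul_assoc)
    then show ?thesis by (simp add: f_def g_def XY vec_eq_iff)
  qed
  obtain K1 where K1: "K1 > 0" "\<And>M. N M \<le> K1 * norm M" using is_norm_bounded_by_norm[OF assms(1)] by blast
  obtain K2 where K2: "K2 > 0" "\<And>M. norm M \<le> K2 * N M" using is_norm_bounds_norm[OF assms(1)] by blast
  obtain H1 where H1: "H1 > 0" "\<And>M::real^'k^'k. norm M \<le> H1 * opnorm M"
    using is_norm_bounds_norm[OF is_norm_opnorm] by blast
  obtain H2 where H2: "H2 > 0" "\<And>M::real^'l^'k. norm M \<le> H2 * opnorm M"
    using is_norm_bounds_norm[OF is_norm_opnorm] by blast
  obtain H3 where H3: "H3 > 0" "\<And>M::real^'l^'l. norm M \<le> H3 * opnorm M"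
    using is_norm_bounds_norm[OF is_norm_opnorm] by blast
  obtain H4 where H4: "H4 > 0" "\<And>M::real^'l^'k. opnorm M \<le> H4 * norm M"
    using is_norm_bounded_by_norm[OF is_norm_opnorm] by blast
  define H where "H = H1 + H2 + H3"
  \<comment> \<open>Each summand is the constant of one of the two bounds; their sum serves
    both.\<close>
  define K where "K = K1 * F * H + H4 * G * K2"
  have H: "H > 0" "H1 \<le> H" "H2 \<le> H" "H3 \<le> H" using H1(1) H2(1) H3(1) by (auto simp: H_def)
  have K: "K > 0" "K1 * F * H \<le> K" "H4 * G * K2 \<le> K"
    using H K1(1) K2(1) F(1) G(1) H4(1) by (auto simp: K_def add_pos_pos)
  have N0: "0 \<le> N M" for M using assms(1) by (simp add: is_norm_def)
  show ?thesis
  proof (rule that[OF K(1)])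
    fix P :: "real^'k^'k" and Q :: "real^'l^'k" and S :: "real^'l^'l"
    have "norm (P, Q, S) \<le> norm P + (norm Q + norm S)"
      using norm_Pair_le[of P "(Q, S)"] norm_Pair_le[of Q S] by linarith
    also have "\<dots> \<le> H * (opnorm P + opnorm Q + opnorm S)"
      using H1(2)[of P] H2(2)[of Q] H3(2)[of S]
        mult_right_mono[OF H(2) opnorm_nonneg[of P]] mult_right_mono[OF H(3) opnorm_nonneg[of Q]]
        mult_right_mono[OF H(4) opnorm_nonneg[of S]] by (simp add: algebra_simps)
    finally have n: "norm (P, Q, S) \<le> H * (opnorm P + opnorm Q + opnorm S)" .
    have "N (f (P, Q, S)) \<le> K1 * (F * norm (P, Q, S))"
      using K1(2)[of "f (P, Q, S)"] mult_left_mono[OF F(2)[of "(P, Q, S)"], of K1] K1(1) by linarith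
    also have "\<dots> \<le> K1 * (F * (H * (opnorm P + opnorm Q + opnorm S)))"
      using n K1(1) F(1) by (intro mult_left_mono) auto
    also have "\<dots> = (K1 * F * H) * (opnorm P + opnorm Q + opnorm S)" by simp
    also have "\<dots> \<le> K * (opnorm P + opnorm Q + opnorm S)"
      using K(2) by (intro mult_right_mono) (auto simp: opnorm_nonneg)
    finally show "N (Y ** block_matrix P Q 0 S ** X) \<le> K * (opnorm P + opnorm Q + opnorm S)"
      by (simp add: f_def)
    have "opnorm Q \<le> H4 * norm (g (f (P, Q, S)))" using H4(2) gf by metis
    also have "\<dots> \<le> H4 * (G * (K2 * N (f (P, Q, S))))"
      using G(2)[of "f (P, Q, S)"] mult_left_mono[OF K2(2)[of "f (P, Q, S)"], of G] G(1) H4(1)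
      by (intro mult_left_mono) linarith+
    also have "\<dots> = (H4 * G * K2) * N (f (P, Q, S))" by simp
    also have "\<dots> \<le> K * N (f (P, Q, S))" using K(3) N0 by (intro mult_right_mono)
    finally show "opnorm Q \<le> K * N (Y ** block_matrix P Q 0 S ** X)" by (simp add: f_def)
  qed
qed

theorem theorem3:
  fixes I :: "'i set"
    and A :: "'i \<Rightarrow> real^('k::finite + 'l::finite)^('k + 'l)"
    and X :: "real^('k + 'l)^('k + 'l)"
    and B :: "'i \<Rightarrow> real^'k^'k"
    and C :: "'i \<Rightarrow> real^'l^'l"
    and D :: "'i \<Rightarrow> real^'l^'k"
    and N :: "real^('k + 'l)^('k + 'l) \<Rightarrow> real"
    and a :: "nat \<Rightarrow> real"
  assumes "compact (A ` I)" and "A ` I \<noteq> {}"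
    and "joint_spectral_radius (A ` I) = 1"
    and "invertible X"
    and "\<And>i. i \<in> I \<Longrightarrow>
           A i = matrix_inv X ** block_matrix (B i) (D i) 0 (C i) ** X"
    and "product_bounded (B ` I)" and "product_bounded (C ` I)"
    and "is_norm N"
    and "\<And>n. n \<ge> 1 \<Longrightarrow> a n = marginal_instability_rate N (A ` I) n"
  shows "(\<exists>\<alpha> :: nat \<Rightarrow> real.
            (\<forall>n\<ge>1. \<alpha> n > 0) \<and>
            (\<forall>n\<ge>1. \<forall>m\<ge>1. \<alpha> (n + m) \<le> \<alpha> n + \<alpha> m) \<and>
            seq_comparable a (\<lambda>n. 1 + \<alpha> n)) \<and>
         weakly_upper_regularly_varying a \<and>
         ((\<lambda>n. a n / real n) \<longlonglongrightarrow> 0 \<or>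
          (\<exists>c K. 0 < c \<and> (\<forall>n\<ge>1. c \<le> a n / real n \<and> a n / real n \<le> K)))"
proof -

  \<comment> \<open>Block form of products along words, and bounds on \<open>N\<close>\<close>
  have ne: "I \<noteq> {}" using assms(2) by simp
  obtain Y where Y: "matrix_inv X = Y" "Y ** X = mat 1" "X ** Y = mat 1"
    using someI_ex[of "\<lambda>Y. X ** Y = mat 1 \<and> Y ** X = mat 1"] assms(4)
    by (auto simp: matrix_inv_def invertible_def)
  define T where "T w = word_offdiag B D C w" for w
  obtain KB where KB: "KB \<ge> 1" "\<And>w. set w \<subseteq> I \<Longrightarrow> opnorm (word_product B w) \<le> KB"
    using product_bounded_word_product[OF assms(6)] by blast
  obtain KC where KC: "KC \<ge> 1" "\<And>w. set w \<subseteq> I \<Longrightarrow> opnorm (word_product C w) \<le> KC"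
    using product_bounded_word_product[OF assms(7)] by blast
  have A_word: "word_product A w =
      Y ** block_matrix (word_product B w) (T w) 0 (word_product C w) ** X" if "set w \<subseteq> I" for w
    unfolding T_def word_product_block[symmetric]
    using that Y assms(5) by (intro word_product_conjugate) auto
  obtain K where K: "K > 0"
    "\<And>(P :: real^'k^'k) (Q :: real^'l^'k) S. N (Y ** block_matrix P Q 0 S ** X) \<le> K * (opnorm P + opnorm Q + opnorm S)"
    "\<And>(P :: real^'k^'k) (Q :: real^'l^'k) S. opnorm Q \<le> K * N (Y ** block_matrix P Q 0 S ** X)"
    using block_triangular_norm_bounds[OF assms(8) Y(2,3)] by blast
  have N_upper: "N (word_product A w) \<le> K * (KB + opnorm (T w) + KC)" if "set w \<subseteq> I" for w
  proof -
    have "N (word_product A w) \<le> K * (opnorm (word_product B w) + opnorm (T w) + opnorm (word_product C w))"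
      unfolding A_word[OF that] by (rule K(2))
    also have "\<dots> \<le> K * (KB + opnorm (T w) + KC)"
      using KB(2)[OF that] KC(2)[OF that] K(1) by (intro mult_left_mono add_mono) auto
    finally show ?thesis .
  qed
  have T_upper: "opnorm (T w) \<le> K * N (word_product A w)" if "set w \<subseteq> I" for w
    unfolding A_word[OF that] by (rule K(3))

  \<comment> \<open>The rate sequence as an attained maximum\<close>
  have prods_ne: "matrix_products (A ` I) n \<noteq> {}" for n
    using words_nonempty[OF ne] by (simp add: matrix_products_image)
  \<comment> \<open>\<open>a\<close> is prescribed from index 1 on only. \<open>r\<close> follows
    the same formula at 0 too, so that the estimates for \<open>\<alpha>\<close> below hold at every
    index.\<close>
  define r where "r n = marginal_instability_rate N (A ` I) n" for n
  have r_eq: "r n = a n" if "n \<ge> 1" for n using assms(9)[OF that] by (simp add: r_def)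
  have r_ge: "N (word_product A w) \<le> r n" if "w \<in> words I n" for w n
    unfolding r_def
    by (rule marginal_instability_rate_max[OF assms(1) prods_ne assms(8)])
      (use that in \<open>simp add: matrix_products_image\<close>)
  have r_attained: "\<exists>w\<in>words I n. r n = N (word_product A w)" for n
    using marginal_instability_rate_max(1)[OF assms(1) prods_ne assms(8), of n]
    by (auto simp: r_def matrix_products_image)

  have r_nonneg: "0 \<le> r n" for n
    using r_attained[of n] assms(8) by (auto simp: is_norm_def)

  \<comment> \<open>A positive lower bound for the rate sequence\<close>
  obtain H where H: "H > 0" "\<And>M. opnorm M \<le> H * N M"
  proof -
    obtain H1 where H1: "H1 > 0" "\<And>M::real^('k + 'l)^('k + 'l). opnorm M \<le> H1 * norm M"
      using is_norm_bounded_by_norm[OF is_norm_opnorm] by blast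
    obtain H2 where H2: "H2 > 0" "\<And>M. norm M \<le> H2 * N M" using is_norm_bounds_norm[OF assms(8)] by blast
    have "opnorm M \<le> (H1 * H2) * N M" for M
      using H1(2)[of M] mult_left_mono[OF H2(2)[of M], of H1] H1(1)
      unfolding mult.assoc by linarith
    then show ?thesis using that[of "H1 * H2"] H1(1) H2(1) by simp
  qed
  have one_le: "1 \<le> H * r n" if "n \<ge> 1" for n
  proof (rule joint_spectral_radius_one_imp[OF compact_imp_bounded[OF assms(1)] assms(2,3) that])
    fix M assume "M \<in> matrix_products (A ` I) n"
    then have "N M \<le> r n" using r_ge by (auto simp: matrix_products_image)
    then show "opnorm M \<le> H * r n"
      using H(2)[of M] mult_left_mono[of "N M" "r n" H] H(1) by linarith
  qed

  \<comment> \<open>The subadditive sequence\<close>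
  define Z where "Z n = ({u. set u \<subseteq> I} \<times> words I n) \<times> {v. set v \<subseteq> I}" for n
  define G where "G = (\<lambda>((u, w), v). opnorm (word_product B u ** T w ** word_product C v))"
  \<comment> \<open>The added 1 gives positivity and, being nonnegative, does not disturb
    subadditivity.\<close>
  define \<alpha> where "\<alpha> n = 1 + (SUP z\<in>Z n. G z)" for n
  have Z_ne: "Z n \<noteq> {}" for n using words_nonempty[OF ne] by (auto simp: Z_def intro!: exI[of _ "[]"])
  \<comment> \<open>Product boundedness keeps the supremum finite although \<open>u\<close> and
    \<open>v\<close> have arbitrary length, and bounds it by a multiple of
    \<open>r n\<close>.\<close>
  have G_upper: "G z \<le> KB * (K * r n) * KC" if mem: "z \<in> Z n" for z n
  proof -
    obtain u w v where z: "z = ((u, w), v)" "set u \<subseteq> I" "w \<in> words I n" "set v \<subseteq> I"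
      using mem by (auto simp: Z_def)
    have T: "opnorm (T w) \<le> K * r n"
      using T_upper[of w] mult_left_mono[OF r_ge[OF z(3)] less_imp_le[OF K(1)]] z(3)
      by (auto simp: words_def simp del: mult_le_cancel_left_pos intro: order_trans)
    have "G z \<le> opnorm (word_product B u ** T w) * opnorm (word_product C v)"
      by (simp add: G_def z opnorm_mult)
    also have "\<dots> \<le> (opnorm (word_product B u) * opnorm (T w)) * opnorm (word_product C v)"
      by (intro mult_right_mono opnorm_mult opnorm_nonneg)
    also have "\<dots> \<le> KB * (K * r n) * KC"
      using T KB KC K(1) z r_nonneg[of n]
      by (intro mult_mono mult_nonneg_nonneg opnorm_nonneg) auto
    finally show ?thesis .
  qed
  have bdd: "bdd_above (G ` Z n)" for n using G_upper by (intro bdd_aboveI2)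
  have G_le: "G z \<le> \<alpha> n - 1" if "z \<in> Z n" for z n
    using cSUP_upper[OF that bdd] by (simp add: \<alpha>_def)
  have \<alpha>_leI: "\<alpha> n \<le> 1 + y" if "\<And>z. z \<in> Z n \<Longrightarrow> G z \<le> y" for n y
    using cSUP_least[OF Z_ne that] by (simp add: \<alpha>_def)
  have G_nonneg: "0 \<le> G z" for z by (auto simp: G_def opnorm_nonneg split: prod.split)
  have \<alpha>_ge1: "1 \<le> \<alpha> n" for n
  proof -
    obtain z where "z \<in> Z n" using Z_ne by blast
    then show ?thesis using G_le[of z n] G_nonneg[of z] by linarith
  qed
  have T_le: "opnorm (T w) \<le> \<alpha> n" if "w \<in> words I n" for w n
    using G_le[of "(([], w), [])" n] that by (simp add: Z_def G_def)
  have subadd: "\<alpha> (n + m) \<le> \<alpha> n + \<alpha> m" for n m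
  proof -
    have "G z \<le> \<alpha> n + \<alpha> m - 1" if z: "z \<in> Z (n + m)" for z
    proof -
      obtain u w v where uwv: "z = ((u, w), v)" "set u \<subseteq> I" "w \<in> words I (n + m)" "set v \<subseteq> I"
        using z by (auto simp: Z_def)
      obtain p q where pq: "w = p @ q" "p \<in> words I n" "q \<in> words I m"
        using uwv(3) by (rule words_addE)
      \<comment> \<open>The inner diagonal products are absorbed into the outer words, which become
        \<open>u @ p\<close> and \<open>q @ v\<close>. Each summand is then a competitor in the
        supremum for \<open>m\<close> or \<open>n\<close>.\<close>
      have "word_product B u ** T w ** word_product C v =
          word_product B (u @ p) ** T q ** word_product C v +
          word_product B u ** T p ** word_product C (q @ v)"
        by (simp add: pq T_def word_offdiag_append word_product_append matrix_add_ldistrib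
            matrix_add_rdistrib matrix_mul_assoc)
      then have "G z \<le> G ((u @ p, q), v) + G ((u, p), q @ v)"
        by (simp add: uwv G_def opnorm_add)
      moreover have "G ((u @ p, q), v) \<le> \<alpha> m - 1" "G ((u, p), q @ v) \<le> \<alpha> n - 1"
        using uwv pq by (auto intro!: G_le simp: Z_def words_def)
      ultimately show ?thesis by linarith
    qed
    then show ?thesis using \<alpha>_leI[of "n + m" "\<alpha> n + \<alpha> m - 1"] by simp
  qed

  \<comment> \<open>Comparability of \<open>a\<close> with \<open>1 + \<alpha>\<close>\<close>
  define R where "R = max (K * (KB + KC + 1)) (2 * H + KB * K * KC)"
  have R: "R > 0" "K * (KB + KC + 1) \<le> R" "2 * H + KB * K * KC \<le> R"
    using K(1) KB(1) KC(1) by (auto simp: R_def less_max_iff_disj)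
  \<comment> \<open>The first entry of the maximum \<open>R\<close> is for this bound. The second is
    for \<open>a_lower\<close>, where \<open>2 * H\<close> absorbs the constant 2 by means of
    \<open>one_le\<close>.\<close>
  have a_upper: "a n \<le> R * (1 + \<alpha> n)" if n: "n \<ge> 1" for n
  proof -
    obtain w where w: "w \<in> words I n" "r n = N (word_product A w)" using r_attained by blast
    have "r n \<le> K * (KB + opnorm (T w) + KC)" using N_upper[of w] w by (simp add: words_def)
    also have "\<dots> \<le> K * ((KB + KC + 1) * (1 + \<alpha> n))"
    proof (intro mult_left_mono)
      have "0 \<le> (KB + KC) * \<alpha> n" using KB(1) KC(1) \<alpha>_ge1[of n] by simp
      then show "KB + opnorm (T w) + KC \<le> (KB + KC + 1) * (1 + \<alpha> n)"
        using T_le[OF w(1)] by (simp add: algebra_simps)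
    qed (use K in simp)
    also have "\<dots> \<le> R * (1 + \<alpha> n)"
      using mult_right_mono[OF R(2), of "1 + \<alpha> n"] \<alpha>_ge1[of n] by (simp add: mult.assoc)
    finally show ?thesis using r_eq[OF n] by simp
  qed
  have a_lower: "1 + \<alpha> n \<le> R * a n" if n: "n \<ge> 1" for n
  proof -
    have "0 < r n" using one_le[OF n] H(1) by (smt (verit) mult_nonneg_nonpos)
    have "\<alpha> n \<le> 1 + KB * (K * r n) * KC" by (rule \<alpha>_leI) (rule G_upper)
    then have "1 + \<alpha> n \<le> (2 * H + KB * K * KC) * r n" using one_le[OF n] by (simp add: algebra_simps)
    also have "\<dots> \<le> R * r n" using R(3) \<open>0 < r n\<close> by (intro mult_right_mono) auto
    finally show ?thesis using r_eq[OF n] by simp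
  qed
  have a_pos: "0 < a n" if "n \<ge> 1" for n
    using a_lower[OF that] \<alpha>_ge1[of n] R(1) by (smt (verit) mult_nonneg_nonpos)

  have comparable: "seq_comparable a (\<lambda>n. 1 + \<alpha> n)"
    unfolding seq_comparable_def
  proof (intro conjI allI impI exI[of _ R])
    fix n :: nat assume n: "n \<ge> 1"
    show "inverse R * (1 + \<alpha> n) \<le> a n" using a_lower[OF n] R(1) by (simp add: field_simps)
    show "0 < 1 + \<alpha> n" using \<alpha>_ge1[of n] by simp
  qed (use a_pos a_upper R in auto)

  \<comment> \<open>Regular variation and the dichotomy for the means\<close>
  have "weakly_upper_regularly_varying a"
    unfolding weakly_upper_regularly_varying_def
  proof (intro conjI allI impI)
    fix m :: nat assume m: "m \<ge> 1"
    have "a (n * m) \<le> (R * real m * R) * a n" if n: "n \<ge> 1" for n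
    proof -
      have "a (n * m) \<le> R * (1 + \<alpha> (n * m))" using n m by (intro a_upper) simp
      \<comment> \<open>Here \<open>m \<ge> 1\<close> also lets the constant 1 be multiplied by
        \<open>m\<close>.\<close>
      also have "\<dots> \<le> R * (real m * (1 + \<alpha> n))"
        using subadditive_mult_le[of \<alpha> m n] subadd m R(1)
        by (intro mult_left_mono) (auto simp: algebra_simps)
      also have "\<dots> \<le> R * (real m * (R * a n))"
        using a_lower[OF n] R(1) by (intro mult_left_mono) auto
      finally show ?thesis by (simp add: mult.assoc)
    qed
    then show "\<exists>K>0. \<forall>n\<ge>1. a (n * m) \<le> K * a n"
      using R(1) m by (intro exI[of _ "R * real m * R"]) auto
  qed (use a_pos in auto)

  moreover have "(\<lambda>n. a n / real n) \<longlonglongrightarrow> 0 \<or>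
      (\<exists>c K. 0 < c \<and> (\<forall>n\<ge>1. c \<le> a n / real n \<and> a n / real n \<le> K))"
  proof (rule subadditive_mean_dichotomy[of \<alpha>])
    assume "(\<lambda>n. \<alpha> n / n) \<longlonglongrightarrow> 0"
    then have "(\<lambda>n. R * (1 / n + \<alpha> n / n)) \<longlonglongrightarrow> R * (0 + 0)"
      by (intro tendsto_intros lim_1_over_n)
    then have lim: "(\<lambda>n. R * (1 / n + \<alpha> n / n)) \<longlonglongrightarrow> 0" by simp
    have "(\<lambda>n. a n / real n) \<longlonglongrightarrow> 0"
    proof (rule tendsto_sandwich[OF _ _ tendsto_const lim])
      show "\<forall>\<^sub>F n in sequentially. 0 \<le> a n / real n"
        using eventually_ge_at_top[of 1] by eventually_elim (simp add: a_pos less_imp_le)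
      show "\<forall>\<^sub>F n in sequentially. a n / real n \<le> R * (1 / n + \<alpha> n / n)"
        using eventually_ge_at_top[of 1]
        by eventually_elim (use a_upper in \<open>simp add: add_divide_distrib[symmetric] divide_right_mono\<close>)
    qed
    then show ?thesis ..
  next
    fix c :: real assume c: "0 < c" "\<And>n. n \<ge> 1 \<Longrightarrow> c \<le> \<alpha> n / n"
    have "c / R \<le> a n / real n \<and> a n / real n \<le> R * (1 + \<alpha> 1)" if n: "n \<ge> 1" for n
    proof
      have "R * a n \<ge> c * n" using a_lower[OF n] c(2)[OF n] n by (simp add: field_simps)
      then show "c / R \<le> a n / real n" using R(1) n by (simp add: field_simps)
      \<comment> \<open>Subadditivity with \<open>n\<close> blocks of length 1 gives linear growth
        at most.\<close>
      have "1 + \<alpha> n \<le> real n * (1 + \<alpha> 1)"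
        using subadditive_mult_le[of \<alpha> n 1] subadd n by (simp add: algebra_simps)
      then have "a n \<le> R * (real n * (1 + \<alpha> 1))"
        using a_upper[OF n] mult_left_mono[of "1 + \<alpha> n" "real n * (1 + \<alpha> 1)" R] R(1) by linarith
      then show "a n / real n \<le> R * (1 + \<alpha> 1)" using n by (simp add: field_simps)
    qed
    then show ?thesis using c(1) R(1) divide_pos_pos by blast
  qed (use subadd \<alpha>_ge1 less_le_trans[OF zero_less_one] in auto)
  moreover have "\<forall>n\<ge>1. \<alpha> n > 0" using \<alpha>_ge1 less_le_trans[OF zero_less_one] by blast
  ultimately show ?thesis using comparable subadd by blast
qed

end
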